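(* Consider the worst-case scenario where client $i$'s gradient $\mathbf{g}_i\in\mathbb{R}^d$ remains constant across all rounds. An adversary observing the client's FedMPDD projections from $T$ rounds, with $m$ directions per round, obtains $T\times m$ linear constraints $(\mathbf{u}_{k,i}^{(j)})^\top\mathbf{g}_i=s_{k,i}^{(j)}$ ($k=1,\dots,T$, $j=1,\dots,m$) on the $d$-dimensional gradient. Privacy is preserved, i.e. the gradient cannot be uniquely recovered from these constraints, as long as $T<\frac{d}{m}$.
   Context: In FedMPDD, at each round $k$ client $i$ draws $m$ random directions $\mathbf{u}_{k,i}^{(1)},\dots,\mathbf{u}_{k,i}^{(m)}\in\{-1,+1\}^d$ with i.i.d. Rademacher entries (known to the adversary through a transmitted random seed) and transmits the $m$ scalars $s_{k,i}^{(j)}=(\mathbf{u}_{k,i}^{(j)})^\top\mathbf{g}_i$. The adversary knows all directions and all transmitted scalars. "Cannot be uniquely recovered" means that the resulting linear system in the unknown gradient has more than one solution in $\mathbb{R}^d$. *)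

theory Defs
  imports "HOL-Probability.Probability"
begin

text \<open>
  One fixed client is considered, so the client index is dropped. Rounds are
  \<open>k \<in> {1..T}\<close>, directions within a round are \<open>j \<in> {1..m}\<close>, and the dimension \<open>d\<close> is
  \<open>CARD('d)\<close>.
\<close>

definition rademacher_rv :: "'w measure \<Rightarrow> ('w \<Rightarrow> real) \<Rightarrow> bool" where
  "rademacher_rv M X \<longleftrightarrow>
     X \<in> borel_measurable M \<and>
     (\<forall>\<omega>\<in>space M. X \<omega> \<in> {- 1, 1}) \<and>
     measure M {\<omega> \<in> space M. X \<omega> = 1} = 1 / 2 \<and>
     measure M {\<omega> \<in> space M. X \<omega> = - 1} = 1 / 2"

text \<open>Independence is joint, over all rounds, directions and coordinates.\<close>

definition rademacher_directions ::
  "'w measure \<Rightarrow> nat \<Rightarrow> nat \<Rightarrow> (nat \<Rightarrow> nat \<Rightarrow> 'w \<Rightarrow> real ^ 'd) \<Rightarrow> bool" where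
  "rademacher_directions M T m u \<longleftrightarrow>
     (\<forall>k\<in>{1..T}. \<forall>j\<in>{1..m}. \<forall>c. rademacher_rv M (\<lambda>\<omega>. u k j \<omega> $ c)) \<and>
     prob_space.indep_vars M (\<lambda>_. borel) (\<lambda>(k, j, c) \<omega>. u k j \<omega> $ c)
       ({1..T} \<times> {1..m} \<times> (UNIV :: 'd set))"

text \<open>Here \<open>g k\<close> is the client's gradient in round \<open>k\<close>.\<close>

definition transmitted_scalar ::
  "(nat \<Rightarrow> nat \<Rightarrow> real ^ 'd) \<Rightarrow> (nat \<Rightarrow> real ^ 'd) \<Rightarrow> nat \<Rightarrow> nat \<Rightarrow> real" where
  "transmitted_scalar v g k j = v k j \<bullet> g k"

text \<open>
  The adversary knows the drawn directions \<open>v\<close> and the scalars \<open>s\<close>, and solves for a single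
  gradient \<open>x\<close> common to all rounds.
\<close>

definition consistent_gradients ::
  "nat \<Rightarrow> nat \<Rightarrow> (nat \<Rightarrow> nat \<Rightarrow> real ^ 'd) \<Rightarrow> (nat \<Rightarrow> nat \<Rightarrow> real) \<Rightarrow> (real ^ 'd) set" where
  "consistent_gradients T m v s = {x. \<forall>k\<in>{1..T}. \<forall>j\<in>{1..m}. v k j \<bullet> x = s k j}"

definition not_uniquely_recoverable ::
  "nat \<Rightarrow> nat \<Rightarrow> (nat \<Rightarrow> nat \<Rightarrow> real ^ 'd) \<Rightarrow> (nat \<Rightarrow> nat \<Rightarrow> real) \<Rightarrow> bool" where
  "not_uniquely_recoverable T m v s \<longleftrightarrow>
     (\<exists>x\<in>consistent_gradients T m v s. \<exists>y\<in>consistent_gradients T m v s. x \<noteq> y)"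

end

theory Submission
  imports Defs
begin

text \<open>The argument is a dimension count, made separately for each outcome. The
  \<open>T * m\<close> observed directions span a subspace of dimension at most
  \<open>T * m < d\<close>, so some nonzero \<open>x\<close> is orthogonal to all of them. Moving
  the true gradient \<open>g0\<close> along \<open>x\<close> changes no transmitted scalar, so
  \<open>g0\<close> and \<open>g0 + x\<close> both solve the adversary's system.\<close>

lemma exists_nonzero_orthogonal_of_card_less:
  fixes S :: "'a::euclidean_space set"
  assumes "finite S" and "card S < DIM('a)"
  obtains x where "x \<noteq> 0" and "\<And>y. y \<in> S \<Longrightarrow> y \<bullet> x = 0"
proof -
  have "dim S < DIM('a)"
    using dim_le_card'[OF assms(1)] assms(2) by linarith
  then obtain x where "x \<noteq> 0" and "\<And>y. y \<in> span S \<Longrightarrow> orthogonal x y"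
    using orthogonal_to_subspace_exists by blast
  then show thesis
    using that span_base by (metis inner_commute orthogonal_def)
qed

theorem lemma5:
  fixes M :: "'w measure"
    and u :: "nat \<Rightarrow> nat \<Rightarrow> 'w \<Rightarrow> real ^ 'd"
    and g :: "nat \<Rightarrow> real ^ 'd"
    and g0 :: "real ^ 'd"
    and T m :: nat
  assumes "prob_space M"
    and "rademacher_directions M T m u"
    and "\<forall>k\<in>{1..T}. g k = g0"
    and "m \<ge> 1"
    and "real T < real CARD('d) / real m"
  shows "\<forall>\<omega>\<in>space M.
           not_uniquely_recoverable T m (\<lambda>k j. u k j \<omega>)
             (transmitted_scalar (\<lambda>k j. u k j \<omega>) g)"
proof
  fix \<omega>
  let ?S = "(\<lambda>(k, j). u k j \<omega>) ` ({1..T} \<times> {1..m})"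
  \<comment> \<open>Since \<open>m\<close> is positive, the denominator in \<open>T < d / m\<close>
    can be cleared.\<close>
  have "real (T * m) < real CARD('d)"
    using assms(4,5) by (simp add: pos_less_divide_eq)
  then have "T * m < DIM(real ^ 'd)"
    by (simp only: of_nat_less_iff DIM_cart DIM_real mult_1_right)
  \<comment> \<open>Only an inequality: the same direction may be drawn more than once.\<close>
  moreover have "card ?S \<le> T * m"
    using card_image_le[of "{1..T} \<times> {1..m}" "\<lambda>(k, j). u k j \<omega>"]
    by (simp add: card_cartesian_product)
  ultimately obtain x where "x \<noteq> 0" and orth: "\<And>y. y \<in> ?S \<Longrightarrow> y \<bullet> x = 0"
    using exists_nonzero_orthogonal_of_card_less[of ?S] by auto
  let ?C = "consistent_gradients T m (\<lambda>k j. u k j \<omega>) (transmitted_scalar (\<lambda>k j. u k j \<omega>) g)"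
  have "u k j \<omega> \<bullet> x = 0" if "k \<in> {1..T}" "j \<in> {1..m}" for k j
    using that by (intro orth) force
  \<comment> \<open>The constancy of \<open>g\<close> enters here: a single vector \<open>g0\<close>
    satisfies the equations of all rounds at once, and \<open>x\<close> solves the homogeneous
    system.\<close>
  then have "g0 \<in> ?C" and "g0 + x \<in> ?C"
    using assms(3) by (auto simp: consistent_gradients_def transmitted_scalar_def inner_add_right)
  moreover have "g0 \<noteq> g0 + x"
    using \<open>x \<noteq> 0\<close> by simp
  ultimately show "not_uniquely_recoverable T m (\<lambda>k j. u k j \<omega>)
      (transmitted_scalar (\<lambda>k j. u k j \<omega>) g)"
    unfolding not_uniquely_recoverable_def by blast
qed

end
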